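(* Consider a power network with ZIP loads as described in the context. For every order $k\ge1$, the order-$k$ differential transformations of the nonlinear power flow equations (Z1)--(Z5) of the context are formally linear equations in $\mathbf{Y}(k)=[E_1(k),F_1(k),\dots,E_N(k),F_N(k)]^T$ and $\Lambda(k)$, namely, respectively: $$\text{(Z1)}:\quad 0=\mathbf{a}_{P,i}\mathbf{Y}(k)-\Delta p_i\Lambda(k)+\varepsilon_i,\qquad i\in\Omega_{PV},$$ $$\text{(Z2)}:\quad 0=\bar{\mathbf{a}}_{P,i}\mathbf{Y}(k)-\Delta p_i\Lambda(k)+\bar\varepsilon_i,\qquad i\in\Omega_{PQ},\quad \bar{\mathbf{a}}_{P,i}=\mathbf{a}_{P,i}-\mathbf{a}_{ZIP,i},\ \ \bar\varepsilon_i=\varepsilon_i+p_i^{sp}\rho(k)-b_{ZIP,i},$$ $$\text{(Z3)}:\quad 0=\bar{\mathbf{a}}_{Q,i}\mathbf{Y}(k)-\Delta q_i\Lambda(k)+\bar\mu_i,\qquad i\in\Omega_{PQ},\quad \bar{\mathbf{a}}_{Q,i}=\mathbf{a}_{Q,i}-\mathbf{c}_{ZIP,i},\ \ \bar\mu_i=\mu_i+q_i^{sp}\rho(k)-d_{ZIP,i},$$ $$\text{(Z4)}:\quad 0=\mathbf{a}_{V,i}\mathbf{Y}(k)+0\,\Lambda(k)+\varsigma_i,\qquad i\in\Omega_{PV},$$ $$\text{(Z5)}:\quad 0=\mathbf{a}_{E,i}\mathbf{Y}(k)+0\,\Lambda(k)-e_i^{sp}\rho(k),\quad 0=\mathbf{a}_{F,i}\mathbf{Y}(k)+0\,\Lambda(k)-f_i^{sp}\rho(k),\qquad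 i\in\Omega_{REF},$$ with all coefficients defined in the context.
   Context: Differential transformation (DT): for a real function $x(t)$, infinitely differentiable near $t=0$, its DT is $X(k)=\frac{1}{k!}\frac{d^kx}{dt^k}(0)$, $k\ge0$; the order-$k$ DT of an equation between such functions is the equation between the order-$k$ coefficients of both sides (the DT of a product $xy$ is $X(k)\otimes Y(k)=\sum_{m=0}^kX(m)Y(k-m)$). $\rho(0)=1$ and $\rho(k)=0$ for $k\ge1$ (DT of the constant $1$). Empty sums are $0$. Network: $N$ buses, partitioned into PQ buses $\Omega_{PQ}$, PV buses $\Omega_{PV}$ and the reference bus $\Omega_{REF}$. Real numbers $g_{ij},b_{ij}$ are the real and imaginary parts of the entries of the bus admittance matrix; $e_i(t),f_i(t)$ are the real and imaginary parts of the voltage phasor of bus $i$; $\lambda(t)$ is the loading parameter; their DTs are $E_i(k),F_i(k),\Lambda(k)$. $\Delta p_i,\Delta q_i,p_i^{sp},q_i^{sp},v_i^{sp},e_i^{sp},f_i^{sp}$ are given real constants. For ZIP loads: complex constants $z_i^{sp}\neq0$, $i_i^{sp}$, and real weights with $\alpha_{i,Z}+\alpha_{i,I}+\alpha_{i,P}=1$, $\beta_{i,Z}+\beta_{i,I}+\beta_{i,P}=1$. ZIP power injections: $p_{i,ZIP}=\alpha_{i,Z}\frac{\mathrm{Re}(z_i^{sp})}{|z_i^{sp}|^2}(e_i^2+f_i^2)+\alpha_{i,I}[e_i\mathrm{Re}(i_i^{sp})+f_i\mathrm{Im}(i_i^{sp})]+\alpha_{i,P}p_i^{sp}$, $q_{i,ZIP}=\beta_{i,Z}\frac{\mathrm{Im}(z_i^{sp})}{|z_i^{sp}|^2}(e_i^2+f_i^2)+\beta_{i,I}[f_i\mathrm{Re}(i_i^{sp})-e_i\mathrm{Im}(i_i^{sp})]+\beta_{i,P}q_i^{sp}$.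 Power flow equations with ZIP loads (sums over $j=1,\dots,N$): (Z1) $p_i^{sp}=-\lambda\Delta p_i+\sum_j g_{ij}(e_ie_j+f_if_j)+\sum_j b_{ij}(f_ie_j-e_if_j)$, $i\in\Omega_{PV}$; (Z2) $p_{i,ZIP}=-\lambda\Delta p_i+\sum_j g_{ij}(e_ie_j+f_if_j)+\sum_j b_{ij}(f_ie_j-e_if_j)$, $i\in\Omega_{PQ}$; (Z3) $q_{i,ZIP}=-\lambda\Delta q_i-\sum_j b_{ij}(e_ie_j+f_if_j)+\sum_j g_{ij}(f_ie_j-e_if_j)$, $i\in\Omega_{PQ}$; (Z4) $(v_i^{sp})^2=e_i^2+f_i^2$, $i\in\Omega_{PV}$; (Z5) $e_i^{sp}=e_i$ and $f_i^{sp}=f_i$, $i\in\Omega_{REF}$. Coefficients (row vectors in $\mathbb{R}^{1\times2N}$, columns ordered as in $\mathbf{Y}(k)$): $\mathbf{a}_{P,i}=[\alpha_{i1},\beta_{i1},\dots,\alpha_{iN},\beta_{iN}]$ with, for $j\ne i$, $\alpha_{ij}=g_{ij}E_i(0)+b_{ij}F_i(0)$, $\beta_{ij}=g_{ij}F_i(0)-b_{ij}E_i(0)$, and $\alpha_{ii}=\sum_{j=1}^N(g_{ij}E_j(0)-b_{ij}F_j(0))+g_{ii}E_i(0)+b_{ii}F_i(0)$, $\beta_{ii}=\sum_{j=1}^N(b_{ij}E_j(0)+g_{ij}F_j(0))-b_{ii}E_i(0)+g_{ii}F_i(0)$. $\mathbf{a}_{Q,i}=[\phi_{i1},\psi_{i1},\dots,\phi_{iN},\psi_{iN}]$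 with, for $j\ne i$, $\phi_{ij}=-b_{ij}E_i(0)+g_{ij}F_i(0)$, $\psi_{ij}=-b_{ij}F_i(0)-g_{ij}E_i(0)$, and $\phi_{ii}=-\sum_{j=1}^N(b_{ij}E_j(0)+g_{ij}F_j(0))-b_{ii}E_i(0)+g_{ii}F_i(0)$, $\psi_{ii}=\sum_{j=1}^N(g_{ij}E_j(0)-b_{ij}F_j(0))-g_{ii}E_i(0)-b_{ii}F_i(0)$. $\mathbf{a}_{V,i}$ has entries $2E_i(0)$, $2F_i(0)$ in the positions of $E_i(k)$, $F_i(k)$ and zeros elsewhere; $\mathbf{a}_{E,i}$ (resp. $\mathbf{a}_{F,i}$) has entry $1$ in the position of $E_i(k)$ (resp. $F_i(k)$) and zeros elsewhere. With $c_{ij}=\sum_{m=1}^{k-1}E_i(m)E_j(k-m)+\sum_{m=1}^{k-1}F_i(m)F_j(k-m)$ and $d_{ij}=\sum_{m=1}^{k-1}F_i(m)E_j(k-m)-\sum_{m=1}^{k-1}E_i(m)F_j(k-m)$: $\varepsilon_i=\sum_j g_{ij}c_{ij}+\sum_j b_{ij}d_{ij}-p_i^{sp}\rho(k)$, $\mu_i=-\sum_j b_{ij}c_{ij}+\sum_j g_{ij}d_{ij}-q_i^{sp}\rho(k)$, $\varsigma_i=c_{ii}-(v_i^{sp})^2\rho(k)$. $\mathbf{a}_{ZIP,i}$ has entries $\tau_{1,i},\tau_{2,i}$ and $\mathbf{c}_{ZIP,i}$ has entries $\tau_{3,i},\tau_{4,i}$ in the positions of $E_i(k),F_i(k)$,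 zeros elsewhere, where $\tau_{1,i}=\alpha_{i,Z}\frac{2E_i(0)\mathrm{Re}(z_i^{sp})}{|z_i^{sp}|^2}+\alpha_{i,I}\mathrm{Re}(i_i^{sp})$, $\tau_{2,i}=\alpha_{i,Z}\frac{2F_i(0)\mathrm{Re}(z_i^{sp})}{|z_i^{sp}|^2}+\alpha_{i,I}\mathrm{Im}(i_i^{sp})$, $\tau_{3,i}=\beta_{i,Z}\frac{2E_i(0)\mathrm{Im}(z_i^{sp})}{|z_i^{sp}|^2}-\beta_{i,I}\mathrm{Im}(i_i^{sp})$, $\tau_{4,i}=\beta_{i,Z}\frac{2F_i(0)\mathrm{Im}(z_i^{sp})}{|z_i^{sp}|^2}+\beta_{i,I}\mathrm{Re}(i_i^{sp})$; $b_{ZIP,i}=\alpha_{i,Z}\frac{\mathrm{Re}(z_i^{sp})}{|z_i^{sp}|^2}c_{ii}+\alpha_{i,P}p_i^{sp}\rho(k)$, $d_{ZIP,i}=\beta_{i,Z}\frac{\mathrm{Im}(z_i^{sp})}{|z_i^{sp}|^2}c_{ii}+\beta_{i,P}q_i^{sp}\rho(k)$. *)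

theory Defs
  imports "HOL-Analysis.Derivative" "Jordan_Normal_Form.Matrix"
begin

no_notation inner (infixl \<open>\<bullet>\<close> 70)

definition smooth_near_0 :: "(real \<Rightarrow> real) \<Rightarrow> bool" where
  "smooth_near_0 x \<longleftrightarrow>
     (\<exists>r>0. \<forall>m. \<forall>t. \<bar>t\<bar> < r \<longrightarrow> ((deriv ^^ m) x) differentiable (at t))"

definition DT :: "(real \<Rightarrow> real) \<Rightarrow> nat \<Rightarrow> real" where
  "DT x k = (deriv ^^ k) x 0 / fact k"

definition rho :: "nat \<Rightarrow> real" where
  "rho k = (if k = 0 then 1 else 0)"

text \<open>Buses are the natural numbers \<open>1, \<dots>, nbus\<close>.  The fields \<open>alphaZ\<close>, \<open>alphaI\<close>, \<open>alphaP\<close>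
  (\<open>betaZ\<close>, \<open>betaI\<close>, \<open>betaP\<close>) are the weights of the active (reactive) ZIP load.\<close>

record zip_network =
  nbus :: nat
  PQ :: "nat set"
  PV :: "nat set"
  REF :: "nat set"
  gmat :: "nat \<Rightarrow> nat \<Rightarrow> real"
  bmat :: "nat \<Rightarrow> nat \<Rightarrow> real"
  dp :: "nat \<Rightarrow> real"
  dq :: "nat \<Rightarrow> real"
  psp :: "nat \<Rightarrow> real"
  qsp :: "nat \<Rightarrow> real"
  vsp :: "nat \<Rightarrow> real"
  esp :: "nat \<Rightarrow> real"
  fsp :: "nat \<Rightarrow> real"
  zsp :: "nat \<Rightarrow> complex"
  isp :: "nat \<Rightarrow> complex"
  alphaZ :: "nat \<Rightarrow> real"
  alphaI :: "nat \<Rightarrow> real"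
  alphaP :: "nat \<Rightarrow> real"
  betaZ :: "nat \<Rightarrow> real"
  betaI :: "nat \<Rightarrow> real"
  betaP :: "nat \<Rightarrow> real"

definition valid_network :: "zip_network \<Rightarrow> bool" where
  "valid_network S \<longleftrightarrow>
     PQ S \<union> PV S \<union> REF S = {1..nbus S} \<and>
     PQ S \<inter> PV S = {} \<and> PQ S \<inter> REF S = {} \<and> PV S \<inter> REF S = {} \<and>
     (\<forall>i\<in>PQ S. zsp S i \<noteq> 0 \<and>
        alphaZ S i + alphaI S i + alphaP S i = 1 \<and>
        betaZ S i + betaI S i + betaP S i = 1)"

definition p_flow ::
  "zip_network \<Rightarrow> (nat \<Rightarrow> real \<Rightarrow> real) \<Rightarrow> (nat \<Rightarrow> real \<Rightarrow> real) \<Rightarrow> nat \<Rightarrow> real \<Rightarrow> real" where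
  "p_flow S e f i t =
     (\<Sum>j=1..nbus S. gmat S i j * (e i t * e j t + f i t * f j t)) +
     (\<Sum>j=1..nbus S. bmat S i j * (f i t * e j t - e i t * f j t))"

definition q_flow ::
  "zip_network \<Rightarrow> (nat \<Rightarrow> real \<Rightarrow> real) \<Rightarrow> (nat \<Rightarrow> real \<Rightarrow> real) \<Rightarrow> nat \<Rightarrow> real \<Rightarrow> real" where
  "q_flow S e f i t =
     - (\<Sum>j=1..nbus S. bmat S i j * (e i t * e j t + f i t * f j t)) +
     (\<Sum>j=1..nbus S. gmat S i j * (f i t * e j t - e i t * f j t))"

definition p_ZIP ::
  "zip_network \<Rightarrow> (nat \<Rightarrow> real \<Rightarrow> real) \<Rightarrow> (nat \<Rightarrow> real \<Rightarrow> real) \<Rightarrow> nat \<Rightarrow> real \<Rightarrow> real" where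
  "p_ZIP S e f i t =
     alphaZ S i * (Re (zsp S i) / (cmod (zsp S i))\<^sup>2) * ((e i t)\<^sup>2 + (f i t)\<^sup>2) +
     alphaI S i * (e i t * Re (isp S i) + f i t * Im (isp S i)) +
     alphaP S i * psp S i"

definition q_ZIP ::
  "zip_network \<Rightarrow> (nat \<Rightarrow> real \<Rightarrow> real) \<Rightarrow> (nat \<Rightarrow> real \<Rightarrow> real) \<Rightarrow> nat \<Rightarrow> real \<Rightarrow> real" where
  "q_ZIP S e f i t =
     betaZ S i * (Im (zsp S i) / (cmod (zsp S i))\<^sup>2) * ((e i t)\<^sup>2 + (f i t)\<^sup>2) +
     betaI S i * (f i t * Re (isp S i) - e i t * Im (isp S i)) +
     betaP S i * qsp S i"

text \<open>\<open>interleave N x y\<close> is \<open>[x 1, y 1, \<dots>, x N, y N]\<close>; positions of a vector start at 0.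
  In the following, \<open>E\<close> and \<open>F\<close> map a bus and an order to a DT coefficient.\<close>

definition interleave :: "nat \<Rightarrow> (nat \<Rightarrow> real) \<Rightarrow> (nat \<Rightarrow> real) \<Rightarrow> real vec" where
  "interleave N x y =
     vec (2 * N) (\<lambda>l. if even l then x (l div 2 + 1) else y (l div 2 + 1))"

definition Yvec ::
  "zip_network \<Rightarrow> (nat \<Rightarrow> nat \<Rightarrow> real) \<Rightarrow> (nat \<Rightarrow> nat \<Rightarrow> real) \<Rightarrow> nat \<Rightarrow> real vec" where
  "Yvec S E F k = interleave (nbus S) (\<lambda>i. E i k) (\<lambda>i. F i k)"

definition unit_pair :: "zip_network \<Rightarrow> nat \<Rightarrow> real \<Rightarrow> real \<Rightarrow> real vec" where
  "unit_pair S i u v =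
     interleave (nbus S) (\<lambda>j. if j = i then u else 0) (\<lambda>j. if j = i then v else 0)"

definition a_P ::
  "zip_network \<Rightarrow> (nat \<Rightarrow> nat \<Rightarrow> real) \<Rightarrow> (nat \<Rightarrow> nat \<Rightarrow> real) \<Rightarrow> nat \<Rightarrow> real vec" where
  "a_P S E F i = interleave (nbus S)
     (\<lambda>j. if j = i
        then (\<Sum>l=1..nbus S. gmat S i l * E l 0 - bmat S i l * F l 0)
             + gmat S i i * E i 0 + bmat S i i * F i 0
        else gmat S i j * E i 0 + bmat S i j * F i 0)
     (\<lambda>j. if j = i
        then (\<Sum>l=1..nbus S. bmat S i l * E l 0 + gmat S i l * F l 0)
             - bmat S i i * E i 0 + gmat S i i * F i 0
        else gmat S i j * F i 0 - bmat S i j * E i 0)"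

definition a_Q ::
  "zip_network \<Rightarrow> (nat \<Rightarrow> nat \<Rightarrow> real) \<Rightarrow> (nat \<Rightarrow> nat \<Rightarrow> real) \<Rightarrow> nat \<Rightarrow> real vec" where
  "a_Q S E F i = interleave (nbus S)
     (\<lambda>j. if j = i
        then - (\<Sum>l=1..nbus S. bmat S i l * E l 0 + gmat S i l * F l 0)
             - bmat S i i * E i 0 + gmat S i i * F i 0
        else - bmat S i j * E i 0 + gmat S i j * F i 0)
     (\<lambda>j. if j = i
        then (\<Sum>l=1..nbus S. gmat S i l * E l 0 - bmat S i l * F l 0)
             - gmat S i i * E i 0 - bmat S i i * F i 0
        else - bmat S i j * F i 0 - gmat S i j * E i 0)"

definition a_V ::
  "zip_network \<Rightarrow> (nat \<Rightarrow> nat \<Rightarrow> real) \<Rightarrow> (nat \<Rightarrow> nat \<Rightarrow> real) \<Rightarrow> nat \<Rightarrow> real vec" where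
  "a_V S E F i = unit_pair S i (2 * E i 0) (2 * F i 0)"

definition a_E :: "zip_network \<Rightarrow> nat \<Rightarrow> real vec" where
  "a_E S i = unit_pair S i 1 0"

definition a_F :: "zip_network \<Rightarrow> nat \<Rightarrow> real vec" where
  "a_F S i = unit_pair S i 0 1"

definition c_conv ::
  "(nat \<Rightarrow> nat \<Rightarrow> real) \<Rightarrow> (nat \<Rightarrow> nat \<Rightarrow> real) \<Rightarrow> nat \<Rightarrow> nat \<Rightarrow> nat \<Rightarrow> real" where
  "c_conv E F k i j =
     (\<Sum>m=1..k-1. E i m * E j (k - m)) + (\<Sum>m=1..k-1. F i m * F j (k - m))"

definition d_conv ::
  "(nat \<Rightarrow> nat \<Rightarrow> real) \<Rightarrow> (nat \<Rightarrow> nat \<Rightarrow> real) \<Rightarrow> nat \<Rightarrow> nat \<Rightarrow> nat \<Rightarrow> real" where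
  "d_conv E F k i j =
     (\<Sum>m=1..k-1. F i m * E j (k - m)) - (\<Sum>m=1..k-1. E i m * F j (k - m))"

definition eps ::
  "zip_network \<Rightarrow> (nat \<Rightarrow> nat \<Rightarrow> real) \<Rightarrow> (nat \<Rightarrow> nat \<Rightarrow> real) \<Rightarrow> nat \<Rightarrow> nat \<Rightarrow> real" where
  "eps S E F k i =
     (\<Sum>j=1..nbus S. gmat S i j * c_conv E F k i j) +
     (\<Sum>j=1..nbus S. bmat S i j * d_conv E F k i j) - psp S i * rho k"

definition mu ::
  "zip_network \<Rightarrow> (nat \<Rightarrow> nat \<Rightarrow> real) \<Rightarrow> (nat \<Rightarrow> nat \<Rightarrow> real) \<Rightarrow> nat \<Rightarrow> nat \<Rightarrow> real" where
  "mu S E F k i =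
     - (\<Sum>j=1..nbus S. bmat S i j * c_conv E F k i j) +
     (\<Sum>j=1..nbus S. gmat S i j * d_conv E F k i j) - qsp S i * rho k"

definition varsig ::
  "zip_network \<Rightarrow> (nat \<Rightarrow> nat \<Rightarrow> real) \<Rightarrow> (nat \<Rightarrow> nat \<Rightarrow> real) \<Rightarrow> nat \<Rightarrow> nat \<Rightarrow> real" where
  "varsig S E F k i = c_conv E F k i i - (vsp S i)\<^sup>2 * rho k"

definition a_ZIP ::
  "zip_network \<Rightarrow> (nat \<Rightarrow> nat \<Rightarrow> real) \<Rightarrow> (nat \<Rightarrow> nat \<Rightarrow> real) \<Rightarrow> nat \<Rightarrow> real vec" where
  "a_ZIP S E F i = unit_pair S i
     (alphaZ S i * (2 * E i 0 * Re (zsp S i) / (cmod (zsp S i))\<^sup>2) + alphaI S i * Re (isp S i))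
     (alphaZ S i * (2 * F i 0 * Re (zsp S i) / (cmod (zsp S i))\<^sup>2) + alphaI S i * Im (isp S i))"

definition c_ZIP ::
  "zip_network \<Rightarrow> (nat \<Rightarrow> nat \<Rightarrow> real) \<Rightarrow> (nat \<Rightarrow> nat \<Rightarrow> real) \<Rightarrow> nat \<Rightarrow> real vec" where
  "c_ZIP S E F i = unit_pair S i
     (betaZ S i * (2 * E i 0 * Im (zsp S i) / (cmod (zsp S i))\<^sup>2) - betaI S i * Im (isp S i))
     (betaZ S i * (2 * F i 0 * Im (zsp S i) / (cmod (zsp S i))\<^sup>2) + betaI S i * Re (isp S i))"

definition b_ZIP ::
  "zip_network \<Rightarrow> (nat \<Rightarrow> nat \<Rightarrow> real) \<Rightarrow> (nat \<Rightarrow> nat \<Rightarrow> real) \<Rightarrow> nat \<Rightarrow> nat \<Rightarrow> real" where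
  "b_ZIP S E F k i =
     alphaZ S i * (Re (zsp S i) / (cmod (zsp S i))\<^sup>2) * c_conv E F k i i
     + alphaP S i * psp S i * rho k"

definition d_ZIP ::
  "zip_network \<Rightarrow> (nat \<Rightarrow> nat \<Rightarrow> real) \<Rightarrow> (nat \<Rightarrow> nat \<Rightarrow> real) \<Rightarrow> nat \<Rightarrow> nat \<Rightarrow> real" where
  "d_ZIP S E F k i =
     betaZ S i * (Im (zsp S i) / (cmod (zsp S i))\<^sup>2) * c_conv E F k i i
     + betaP S i * qsp S i * rho k"

definition abar_P ::
  "zip_network \<Rightarrow> (nat \<Rightarrow> nat \<Rightarrow> real) \<Rightarrow> (nat \<Rightarrow> nat \<Rightarrow> real) \<Rightarrow> nat \<Rightarrow> real vec" where
  "abar_P S E F i = a_P S E F i - a_ZIP S E F i"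

definition abar_Q ::
  "zip_network \<Rightarrow> (nat \<Rightarrow> nat \<Rightarrow> real) \<Rightarrow> (nat \<Rightarrow> nat \<Rightarrow> real) \<Rightarrow> nat \<Rightarrow> real vec" where
  "abar_Q S E F i = a_Q S E F i - c_ZIP S E F i"

definition epsbar ::
  "zip_network \<Rightarrow> (nat \<Rightarrow> nat \<Rightarrow> real) \<Rightarrow> (nat \<Rightarrow> nat \<Rightarrow> real) \<Rightarrow> nat \<Rightarrow> nat \<Rightarrow> real" where
  "epsbar S E F k i = eps S E F k i + psp S i * rho k - b_ZIP S E F k i"

definition mubar ::
  "zip_network \<Rightarrow> (nat \<Rightarrow> nat \<Rightarrow> real) \<Rightarrow> (nat \<Rightarrow> nat \<Rightarrow> real) \<Rightarrow> nat \<Rightarrow> nat \<Rightarrow> real" where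
  "mubar S E F k i = mu S E F k i + qsp S i * rho k - d_ZIP S E F k i"

text \<open>An equation \<open>0 = a \<bullet> Y(k) - c * \<Lambda>(k) + r\<close> is formally linear in \<open>Y(k)\<close> and \<open>\<Lambda>(k)\<close> if
  \<open>a\<close>, \<open>c\<close> and \<open>r\<close> do not involve these unknowns.  As \<open>a\<close> and \<open>r\<close> are written as functions of
  all the coefficients in \<open>E\<close> and \<open>F\<close>, this means that they only depend on those of order
  below \<open>k\<close>.\<close>

definition lower_order ::
  "zip_network \<Rightarrow> nat \<Rightarrow> ((nat \<Rightarrow> nat \<Rightarrow> real) \<Rightarrow> (nat \<Rightarrow> nat \<Rightarrow> real) \<Rightarrow> 'a) \<Rightarrow> bool" where
  "lower_order S k A \<longleftrightarrow>
     (\<forall>E F E' F'. (\<forall>i\<in>{1..nbus S}. \<forall>m<k. E i m = E' i m \<and> F i m = F' i m)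
        \<longrightarrow> A E F = A E' F')"

end

theory Submission
  imports Defs
begin

text \<open>Whenever a function has a family of normalised derivatives (Taylor coefficient functions) on
  one common interval around 0, its DT is that family evaluated at 0.  Such families exist for sums
  and, by the Leibniz rule, for products, so the DT of every power flow equation can be computed term by
  term.  Splitting off the terms \<open>m = 0\<close> and \<open>m = k\<close> of each convolution gives
  the part that is linear in the order-\<open>k\<close> unknowns; the remaining terms only involve lower orders.
  The reactive equations (Z3) are the active equations (Z2) of a dual network.\<close>

section \<open>Calculus of Taylor coefficient families\<close>

definition has_DT :: "(real \<Rightarrow> real) \<Rightarrow> (nat \<Rightarrow> real) \<Rightarrow> bool" where
  "has_DT x X \<longleftrightarrow> (\<exists>P r. r > 0 \<and> (\<forall>k. P k 0 = X k) \<and>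
     (\<forall>t. \<bar>t\<bar> < r \<longrightarrow> P 0 t = x t \<and>
        (\<forall>m. (P m has_real_derivative real (Suc m) * P (Suc m) t) (at t))))"

text \<open>Dividing the m-th derivative by \<open>fact m\<close> gives the family; the factor
  \<open>Suc m\<close> in its recursion comes from \<open>fact (Suc m) = Suc m * fact m\<close>.
  Smoothness supplies one radius valid for all orders.\<close>

lemma has_DT_smooth:
  assumes "smooth_near_0 x"
  shows "has_DT x (DT x)"
proof -
  obtain r where r: "r > 0" "\<And>m t. \<bar>t\<bar> < r \<Longrightarrow> ((deriv ^^ m) x) differentiable (at t)"
    using assms unfolding smooth_near_0_def by auto
  define P where "P m t = (deriv ^^ m) x t / fact m" for m t
  have "(P m has_real_derivative real (Suc m) * P (Suc m) t) (at t)" if "\<bar>t\<bar> < r" for m t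
  proof -
    have "((deriv ^^ m) x has_real_derivative (deriv ^^ Suc m) x t) (at t)"
      using r(2)[OF that, of m]
      by (simp add: DERIV_deriv_iff_real_differentiable)
    then have "(P m has_real_derivative (deriv ^^ Suc m) x t / fact m) (at t)"
      unfolding P_def by (rule DERIV_cdivide)
    then show ?thesis
      by (simp add: P_def field_simps del: of_nat_Suc)
  qed
  then show ?thesis
    unfolding has_DT_def using r(1)
    by (intro exI[of _ P] exI[of _ r]) (auto simp: P_def DT_def)
qed

text \<open>The recursion forces \<open>P m\<close> to be the m-th derivative over
  \<open>fact m\<close> on the whole interval, so any family found for \<open>x\<close> determines
  its DT.\<close>

lemma has_DT_unique:
  assumes "has_DT x X"
  shows "DT x k = X k"
proof -
  obtain P r where P: "r > 0" "\<And>k. P k 0 = X k" "\<And>t. \<bar>t\<bar> < r \<Longrightarrow> P 0 t = x t"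
    "\<And>m t. \<bar>t\<bar> < r \<Longrightarrow> (P m has_real_derivative real (Suc m) * P (Suc m) t) (at t)"
    using assms unfolding has_DT_def by blast
  have "(deriv ^^ m) x t = fact m * P m t" if "\<bar>t\<bar> < r" for m t
    using that
  \<comment> \<open>The derivative at \<open>t\<close> depends on values near \<open>t\<close>, so
    the induction hypothesis is needed on a neighbourhood of \<open>t\<close>.\<close>
  proof (induction m arbitrary: t)
    case 0
    then show ?case using P(3) by simp
  next
    case (Suc m)
    have "\<forall>\<^sub>F s in nhds t. s \<in> {-r<..<r}"
      using Suc.prems by (intro eventually_nhds_in_open) auto
    then have "\<forall>\<^sub>F s in nhds t. (deriv ^^ m) x s = fact m * P m s"
      by eventually_elim (auto intro: Suc.IH)
    then have "deriv ((deriv ^^ m) x) t = deriv (\<lambda>s. fact m * P m s) t"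
      by (rule deriv_cong_ev) simp
    also have "\<dots> = fact m * (real (Suc m) * P (Suc m) t)"
      by (intro DERIV_imp_deriv DERIV_cmult P(4) Suc.prems)
    finally show ?case by (simp add: algebra_simps)
  qed
  from this[of 0 k] show ?thesis using P(1,2) by (simp add: DT_def)
qed

text \<open>The family is constant in \<open>t\<close>; its recursion holds because
  \<open>rho (Suc m) = 0\<close>.\<close>

lemma has_DT_const: "has_DT (\<lambda>_. c) (\<lambda>k. c * rho k)"
  unfolding has_DT_def
  by (intro exI[of _ "\<lambda>k _. c * rho k"] exI[of _ 1]) (auto simp: rho_def)

lemma has_DT_add:
  assumes "has_DT x X" "has_DT y Y"
  shows "has_DT (\<lambda>t. x t + y t) (\<lambda>k. X k + Y k)"
proof -
  obtain P r where P: "r > 0" "\<And>k. P k 0 = X k" "\<And>t. \<bar>t\<bar> < r \<Longrightarrow> P 0 t = x t"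
    "\<And>m t. \<bar>t\<bar> < r \<Longrightarrow> (P m has_real_derivative real (Suc m) * P (Suc m) t) (at t)"
    using assms(1) unfolding has_DT_def by blast
  obtain Q s where Q: "s > 0" "\<And>k. Q k 0 = Y k" "\<And>t. \<bar>t\<bar> < s \<Longrightarrow> Q 0 t = y t"
    "\<And>m t. \<bar>t\<bar> < s \<Longrightarrow> (Q m has_real_derivative real (Suc m) * Q (Suc m) t) (at t)"
    using assms(2) unfolding has_DT_def by blast
  have "((\<lambda>t. P m t + Q m t) has_real_derivative
      real (Suc m) * (P (Suc m) t + Q (Suc m) t)) (at t)" if "\<bar>t\<bar> < min r s" for m t
    unfolding distrib_left using that by (intro DERIV_add P(4) Q(4)) auto
  then show ?thesis
    unfolding has_DT_def using P(1,2,3) Q(1,2,3)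
    by (intro exI[of _ "\<lambda>m t. P m t + Q m t"] exI[of _ "min r s"]) auto
qed

text \<open>Leibniz rule: after division by factorials the binomial coefficients disappear, and the
  family of the product is the Cauchy product of the two families.\<close>

lemma has_DT_mult:
  assumes "has_DT x X" "has_DT y Y"
  shows "has_DT (\<lambda>t. x t * y t) (\<lambda>k. \<Sum>m\<le>k. X m * Y (k - m))"
proof -
  obtain P r where P: "r > 0" "\<And>k. P k 0 = X k" "\<And>t. \<bar>t\<bar> < r \<Longrightarrow> P 0 t = x t"
    "\<And>m t. \<bar>t\<bar> < r \<Longrightarrow> (P m has_real_derivative real (Suc m) * P (Suc m) t) (at t)"
    using assms(1) unfolding has_DT_def by blast
  obtain Q s where Q: "s > 0" "\<And>k. Q k 0 = Y k" "\<And>t. \<bar>t\<bar> < s \<Longrightarrow> Q 0 t = y t"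
    "\<And>m t. \<bar>t\<bar> < s \<Longrightarrow> (Q m has_real_derivative real (Suc m) * Q (Suc m) t) (at t)"
    using assms(2) unfolding has_DT_def by blast
  have "((\<lambda>t. \<Sum>j\<le>m. P j t * Q (m - j) t) has_real_derivative
      real (Suc m) * (\<Sum>j\<le>Suc m. P j t * Q (Suc m - j) t)) (at t)"
    if t: "\<bar>t\<bar> < min r s" for m t
  proof -
    have "((\<lambda>t. \<Sum>j\<le>m. P j t * Q (m - j) t) has_real_derivative
      (\<Sum>j\<le>m. real (Suc j) * P (Suc j) t * Q (m - j) t +
         real (Suc (m - j)) * Q (Suc (m - j)) t * P j t)) (at t)"
      using t by (intro DERIV_sum DERIV_mult P(4) Q(4)) auto
    \<comment> \<open>The weight is split as \<open>Suc m = j + (Suc m - j)\<close>, one share for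
      each factor to be differentiated.\<close>
    moreover have "real (Suc m) * (\<Sum>j\<le>Suc m. P j t * Q (Suc m - j) t) =
        (\<Sum>j\<le>Suc m. real j * P j t * Q (Suc m - j) t) +
        (\<Sum>j\<le>Suc m. real (Suc m - j) * Q (Suc m - j) t * P j t)"
      unfolding sum_distrib_left sum.distrib[symmetric]
      by (intro sum.cong refl) (simp add: of_nat_diff algebra_simps)
    \<comment> \<open>The term \<open>j = 0\<close> has weight 0, so the sum starts at 1 and is
      shifted down by one.\<close>
    moreover have "(\<Sum>j\<le>Suc m. real j * P j t * Q (Suc m - j) t) =
        (\<Sum>j\<le>m. real (Suc j) * P (Suc j) t * Q (m - j) t)"
      by (subst sum.atMost_Suc_shift) simp
    \<comment> \<open>Here the last term, \<open>j = Suc m\<close>, has weight 0 and drops without a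
      shift.\<close>
    moreover have "(\<Sum>j\<le>Suc m. real (Suc m - j) * Q (Suc m - j) t * P j t) =
        (\<Sum>j\<le>m. real (Suc (m - j)) * Q (Suc (m - j)) t * P j t)"
      unfolding sum.atMost_Suc by (simp add: Suc_diff_le cong: sum.cong_simp del: of_nat_Suc of_nat_diff)
    ultimately show ?thesis
      by (simp add: sum.distrib del: of_nat_Suc sum.atMost_Suc)
  qed
  then show ?thesis
    unfolding has_DT_def using P(1,2,3) Q(1,2,3)
    by (intro exI[of _ "\<lambda>m t. \<Sum>j\<le>m. P j t * Q (m - j) t"] exI[of _ "min r s"]) auto
qed

text \<open>Convolution with \<open>c * rho\<close>, the DT of a constant, keeps only the term
  \<open>m = 0\<close>.\<close>

lemma has_DT_cmult:
  assumes "has_DT x X"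
  shows "has_DT (\<lambda>t. c * x t) (\<lambda>k. c * X k)"
proof -
  have "(\<Sum>m\<le>k. c * rho m * X (k - m)) = c * X k" for k
    by (cases k) (simp_all add: rho_def sum.atMost_Suc_shift del: sum.atMost_Suc)
  with has_DT_mult[OF has_DT_const assms, of c] show ?thesis by simp
qed

lemma has_DT_sum:
  assumes "finite A" "\<And>j. j \<in> A \<Longrightarrow> has_DT (x j) (X j)"
  shows "has_DT (\<lambda>t. \<Sum>j\<in>A. x j t) (\<lambda>k. \<Sum>j\<in>A. X j k)"
  using assms
proof (induction A rule: finite_induct)
  case empty
  then show ?case using has_DT_const[of 0] by simp
next
  case (insert a A)
  then show ?case by (simp add: has_DT_add)
qed

section \<open>Convolutions and interleaved vectors\<close>

text \<open>For \<open>k \<ge> 1\<close> the indices 0 and \<open>k\<close> are distinct, and only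
  their terms contain factors of order \<open>k\<close>. For \<open>k = 1\<close> the remaining sum
  is empty.\<close>

lemma convolution_split_ends:
  fixes X Y :: "nat \<Rightarrow> real"
  assumes "k \<ge> 1"
  shows "(\<Sum>m\<le>k. X m * Y (k - m)) = X 0 * Y k + X k * Y 0 + (\<Sum>m=1..k-1. X m * Y (k - m))"
proof -
  have "{..k} = insert 0 (insert k {1..k-1})" using assms by auto
  then show ?thesis using assms by simp
qed

lemma interleave_scalar_prod:
  "interleave N x y \<bullet> interleave N x' y' = (\<Sum>j=1..N. x j * x' j + y j * y' j)"
proof -
  have "interleave N x y \<bullet> interleave N x' y' =
      (\<Sum>l=0..<2*N. if even l then x (l div 2 + 1) * x' (l div 2 + 1)
                                else y (l div 2 + 1) * y' (l div 2 + 1))"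
    unfolding scalar_prod_def interleave_def by (auto intro!: sum.cong)
  \<comment> \<open>Each induction step adds the positions \<open>2 * N\<close> and
    \<open>2 * N + 1\<close>, which hold the pair of bus \<open>N + 1\<close>.\<close>
  also have "\<dots> = (\<Sum>j=1..N. x j * x' j + y j * y' j)"
    by (induction N) auto
  finally show ?thesis .
qed

lemma interleave_carrier [simp]: "interleave N x y \<in> carrier_vec (2 * N)"
  by (simp add: interleave_def)

lemma unit_pair_scalar_prod:
  assumes "i \<in> {1..nbus S}"
  shows "unit_pair S i u v \<bullet> Yvec S E F k = u * E i k + v * F i k"
proof -
  have "unit_pair S i u v \<bullet> Yvec S E F k =
      (\<Sum>j=1..nbus S. if j = i then u * E j k + v * F j k else 0)"
    unfolding unit_pair_def Yvec_def interleave_scalar_prod by (intro sum.cong) auto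
  then show ?thesis using assms by simp
qed

text \<open>For \<open>k \<ge> 1\<close> the right side collects the terms of the flow convolutions
  in which one factor has order \<open>k\<close> and the other order 0.\<close>

lemma a_P_scalar_prod:
  assumes "i \<in> {1..nbus S}"
  shows "a_P S E F i \<bullet> Yvec S E F k =
    (\<Sum>j=1..nbus S. gmat S i j * (E i 0 * E j k + E i k * E j 0 + F i 0 * F j k + F i k * F j 0) +
       bmat S i j * (F i 0 * E j k + F i k * E j 0 - E i 0 * F j k - E i k * F j 0))"
proof -
  \<comment> \<open>\<open>A\<close> and \<open>B\<close> are the excess of the diagonal entries
    over the off-diagonal formula taken at \<open>j = i\<close>, so the case distinction becomes a
    single correction at bus \<open>i\<close>.\<close>
  define A where "A = (\<Sum>l=1..nbus S. gmat S i l * E l 0 - bmat S i l * F l 0)"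
  define B where "B = (\<Sum>l=1..nbus S. bmat S i l * E l 0 + gmat S i l * F l 0)"
  have "a_P S E F i \<bullet> Yvec S E F k =
     (\<Sum>j=1..nbus S. (gmat S i j * E i 0 + bmat S i j * F i 0) * E j k +
        (gmat S i j * F i 0 - bmat S i j * E i 0) * F j k +
        (if j = i then A * E i k + B * F i k else 0))"
    unfolding a_P_def Yvec_def interleave_scalar_prod A_def[symmetric] B_def[symmetric]
    by (intro sum.cong refl) (simp add: algebra_simps)
  also have "\<dots> = (\<Sum>j=1..nbus S. (gmat S i j * E i 0 + bmat S i j * F i 0) * E j k +
        (gmat S i j * F i 0 - bmat S i j * E i 0) * F j k) + (A * E i k + B * F i k)"
    using assms by (simp add: sum.distrib)
  \<comment> \<open>Expanding \<open>A\<close> and \<open>B\<close> turns the correction into the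
    terms with the factors \<open>E i k\<close> and \<open>F i k\<close>.\<close>
  finally show ?thesis
    unfolding A_def B_def sum_distrib_right sum.distrib[symmetric]
    by (simp add: algebra_simps)
qed

section \<open>Order-k transformations of flow, load and voltage terms\<close>

lemma DT_p_flow_eq:
  assumes e: "\<And>i. i \<in> {1..nbus S} \<Longrightarrow> smooth_near_0 (e i)"
    and f: "\<And>i. i \<in> {1..nbus S} \<Longrightarrow> smooth_near_0 (f i)"
    and lam: "smooth_near_0 lam" and k: "k \<ge> 1" and i: "i \<in> {1..nbus S}"
  shows "DT (\<lambda>t. - lam t * dp S i + p_flow S e f i t) k =
    a_P S (\<lambda>i. DT (e i)) (\<lambda>i. DT (f i)) i \<bullet> Yvec S (\<lambda>i. DT (e i)) (\<lambda>i. DT (f i)) k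
      - dp S i * DT lam k + eps S (\<lambda>i. DT (e i)) (\<lambda>i. DT (f i)) k i"
proof -
  let ?c = "\<lambda>x y k. \<Sum>m\<le>k. DT x m * DT y (k - m)"
  note E = has_DT_smooth[OF e] and F = has_DT_smooth[OF f]
  \<comment> \<open>Differences are written with negative factors so that \<open>has_DT_add\<close>
    and \<open>has_DT_cmult\<close> cover them.\<close>
  have "has_DT (\<lambda>t. (- dp S i) * lam t +
      ((\<Sum>j=1..nbus S. gmat S i j * (e i t * e j t + f i t * f j t)) +
       (\<Sum>j=1..nbus S. bmat S i j * (f i t * e j t + (-1) * (e i t * f j t)))))
     (\<lambda>k. (- dp S i) * DT lam k +
      ((\<Sum>j=1..nbus S. gmat S i j * (?c (e i) (e j) k + ?c (f i) (f j) k)) +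
       (\<Sum>j=1..nbus S. bmat S i j * (?c (f i) (e j) k + (-1) * ?c (e i) (f j) k))))"
    using i by (intro has_DT_add has_DT_cmult has_DT_sum has_DT_mult has_DT_smooth[OF lam] E F
        finite_atLeastAtMost) auto
  from has_DT_unique[OF this, of k]
  have "DT (\<lambda>t. - lam t * dp S i + p_flow S e f i t) k =
     (- dp S i) * DT lam k +
      ((\<Sum>j=1..nbus S. gmat S i j * (?c (e i) (e j) k + ?c (f i) (f j) k)) +
       (\<Sum>j=1..nbus S. bmat S i j * (?c (f i) (e j) k + (-1) * ?c (e i) (f j) k)))"
    by (simp add: p_flow_def mult.commute)
  \<comment> \<open>The end terms of the convolutions form the product with \<open>a_P\<close>, the
    inner ones form \<open>c_conv\<close> and \<open>d_conv\<close>; the summand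
    \<open>psp S i * rho k\<close> of \<open>eps\<close> is zero since
    \<open>k \<ge> 1\<close>.\<close>
  then show ?thesis
    using k
    unfolding a_P_scalar_prod[OF i] eps_def c_conv_def d_conv_def convolution_split_ends[OF k]
    by (simp add: rho_def sum.distrib sum_subtractf algebra_simps)
qed

text \<open>The impedance part is quadratic and contributes convolutions, the current part is linear
  and contributes its coefficients directly, and the constant-power part appears only as a multiple
  of \<open>rho k\<close>.\<close>

lemma DT_p_ZIP_eq:
  assumes e: "smooth_near_0 (e i)" and f: "smooth_near_0 (f i)"
    and k: "k \<ge> 1" and i: "i \<in> {1..nbus S}"
  shows "DT (\<lambda>t. p_ZIP S e f i t) k =
    a_ZIP S (\<lambda>i. DT (e i)) (\<lambda>i. DT (f i)) i \<bullet> Yvec S (\<lambda>i. DT (e i)) (\<lambda>i. DT (f i)) k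
      + b_ZIP S (\<lambda>i. DT (e i)) (\<lambda>i. DT (f i)) k i"
proof -
  let ?c = "\<lambda>x k. \<Sum>m\<le>k. DT x m * DT x (k - m)"
  define a where "a = alphaZ S i * (Re (zsp S i) / (cmod (zsp S i))\<^sup>2)"
  note E = has_DT_smooth[OF e] and F = has_DT_smooth[OF f]
  have "has_DT (\<lambda>t. a * (e i t * e i t + f i t * f i t) +
      alphaI S i * (Re (isp S i) * e i t + Im (isp S i) * f i t) + alphaP S i * psp S i)
     (\<lambda>k. a * (?c (e i) k + ?c (f i) k) +
      alphaI S i * (Re (isp S i) * DT (e i) k + Im (isp S i) * DT (f i) k)
      + alphaP S i * psp S i * rho k)"
    by (intro has_DT_add has_DT_cmult has_DT_const has_DT_mult E F)
  from has_DT_unique[OF this, of k]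
  have "DT (\<lambda>t. p_ZIP S e f i t) k = a * (?c (e i) k + ?c (f i) k) +
      alphaI S i * (Re (isp S i) * DT (e i) k + Im (isp S i) * DT (f i) k)
      + alphaP S i * psp S i * rho k"
    by (simp add: p_ZIP_def a_def mult.commute power2_eq_square)
  \<comment> \<open>In a square both end terms of the convolution are equal, which is the source of
    the factor 2.\<close>
  moreover have "a_ZIP S (\<lambda>i. DT (e i)) (\<lambda>i. DT (f i)) i =
      unit_pair S i (2 * a * DT (e i) 0 + alphaI S i * Re (isp S i))
        (2 * a * DT (f i) 0 + alphaI S i * Im (isp S i))"
    unfolding a_ZIP_def a_def by (simp add: mult_ac)
  ultimately show ?thesis
    unfolding b_ZIP_def a_def[symmetric] c_conv_def convolution_split_ends[OF k]
    by (simp add: unit_pair_scalar_prod[OF i] algebra_simps)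
qed

lemma DT_voltage_square:
  assumes e: "smooth_near_0 (e i)" and f: "smooth_near_0 (f i)"
    and k: "k \<ge> 1" and i: "i \<in> {1..nbus S}"
  shows "DT (\<lambda>t. (e i t)\<^sup>2 + (f i t)\<^sup>2) k =
    a_V S (\<lambda>i. DT (e i)) (\<lambda>i. DT (f i)) i \<bullet> Yvec S (\<lambda>i. DT (e i)) (\<lambda>i. DT (f i)) k
      + varsig S (\<lambda>i. DT (e i)) (\<lambda>i. DT (f i)) k i"
proof -
  note E = has_DT_smooth[OF e] and F = has_DT_smooth[OF f]
  have "DT (\<lambda>t. (e i t)\<^sup>2 + (f i t)\<^sup>2) k =
      (\<Sum>m\<le>k. DT (e i) m * DT (e i) (k - m)) + (\<Sum>m\<le>k. DT (f i) m * DT (f i) (k - m))"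
    unfolding power2_eq_square by (intro has_DT_unique has_DT_add has_DT_mult E F)
  then show ?thesis
    using k unfolding a_V_def varsig_def c_conv_def convolution_split_ends[OF k]
    by (simp add: unit_pair_scalar_prod[OF i] rho_def)
qed

section \<open>Dependence on lower orders only\<close>

text \<open>The entries use order 0 alone, which lies below \<open>k\<close>; the diagonal sums use
  it at every bus.\<close>

lemma lower_order_a_P:
  assumes "k \<ge> 1" "i \<in> {1..nbus S}"
  shows "lower_order S k (\<lambda>E F. a_P S E F i)"
  unfolding lower_order_def
proof (intro allI impI)
  fix E F E' F' :: "nat \<Rightarrow> nat \<Rightarrow> real"
  assume "\<forall>i\<in>{1..nbus S}. \<forall>m<k. E i m = E' i m \<and> F i m = F' i m"
  then have *: "E j 0 = E' j 0" "F j 0 = F' j 0" if "j \<in> {1..nbus S}" for j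
    using assms(1) that by auto
  have "(\<Sum>l=1..nbus S. gmat S i l * E l 0 - bmat S i l * F l 0)
      = (\<Sum>l=1..nbus S. gmat S i l * E' l 0 - bmat S i l * F' l 0)"
    "(\<Sum>l=1..nbus S. bmat S i l * E l 0 + gmat S i l * F l 0)
      = (\<Sum>l=1..nbus S. bmat S i l * E' l 0 + gmat S i l * F' l 0)"
    by (auto intro!: sum.cong simp: *)
  then show "a_P S E F i = a_P S E' F' i"
    unfolding a_P_def by (simp only: *[OF assms(2)])
qed

text \<open>For \<open>m\<close> between 1 and \<open>k - 1\<close> both \<open>m\<close> and
  \<open>k - m\<close> stay below \<open>k\<close>.\<close>

lemma lower_order_conv:
  assumes "i \<in> {1..nbus S}" "j \<in> {1..nbus S}"
  shows "lower_order S k (\<lambda>E F. (c_conv E F k i j, d_conv E F k i j))"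
  unfolding lower_order_def
proof (intro allI impI)
  fix E F E' F' :: "nat \<Rightarrow> nat \<Rightarrow> real"
  assume *: "\<forall>i\<in>{1..nbus S}. \<forall>m<k. E i m = E' i m \<and> F i m = F' i m"
  have "E l m = E' l m \<and> F l m = F' l m \<and> E l (k - m) = E' l (k - m) \<and> F l (k - m) = F' l (k - m)"
    if "m \<in> {1..k-1}" "l \<in> {1..nbus S}" for l m
    using * that by auto
  then show "(c_conv E F k i j, d_conv E F k i j) = (c_conv E' F' k i j, d_conv E' F' k i j)"
    using assms by (simp add: c_conv_def d_conv_def)
qed

lemma lower_order_eps:
  assumes "i \<in> {1..nbus S}"
  shows "lower_order S k (\<lambda>E F. eps S E F k i)"
  unfolding lower_order_def
proof (intro allI impI)
  fix E F E' F' :: "nat \<Rightarrow> nat \<Rightarrow> real"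
  assume "\<forall>i\<in>{1..nbus S}. \<forall>m<k. E i m = E' i m \<and> F i m = F' i m"
  then have "c_conv E F k i j = c_conv E' F' k i j \<and> d_conv E F k i j = d_conv E' F' k i j"
    if "j \<in> {1..nbus S}" for j
    using lower_order_conv[OF assms that, of k] unfolding lower_order_def by blast
  then show "eps S E F k i = eps S E' F' k i"
    by (simp add: eps_def)
qed

lemma lower_order_voltage_square:
  assumes "k \<ge> 1" "i \<in> {1..nbus S}"
  shows "lower_order S k (\<lambda>E F. (a_V S E F i, varsig S E F k i))"
  using lower_order_conv[OF assms(2,2), of k] assms
  unfolding lower_order_def a_V_def varsig_def by auto

lemma lower_order_ZIP:
  assumes "k \<ge> 1" "i \<in> {1..nbus S}"
  shows "lower_order S k (\<lambda>E F. (a_ZIP S E F i, b_ZIP S E F k i))"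
  using lower_order_conv[OF assms(2,2), of k] assms
  unfolding lower_order_def a_ZIP_def b_ZIP_def by auto

section \<open>Load buses and the duality of active and reactive power\<close>

text \<open>The linear equation is the difference of the two transformed sides. The network is
  arbitrary so that \<open>dual_network S\<close> can be inserted later.\<close>

lemma ZIP_active_power:
  assumes e: "\<And>i. i \<in> {1..nbus S} \<Longrightarrow> smooth_near_0 (e i)"
    and f: "\<And>i. i \<in> {1..nbus S} \<Longrightarrow> smooth_near_0 (f i)"
    and lam: "smooth_near_0 lam" and k: "k \<ge> 1" and i: "i \<in> {1..nbus S}"
  defines "E \<equiv> \<lambda>i. DT (e i)" and "F \<equiv> \<lambda>i. DT (f i)"
  shows "lower_order S k (\<lambda>E' F'. (abar_P S E' F' i, epsbar S E' F' k i)) \<and>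
    (DT (\<lambda>t. p_ZIP S e f i t) k = DT (\<lambda>t. - lam t * dp S i + p_flow S e f i t) k \<longleftrightarrow>
     0 = abar_P S E F i \<bullet> Yvec S E F k - dp S i * DT lam k + epsbar S E F k i)"
proof
  show "lower_order S k (\<lambda>E' F'. (abar_P S E' F' i, epsbar S E' F' k i))"
    using lower_order_a_P[OF k i] lower_order_eps[OF i, of k] lower_order_ZIP[OF k i]
    unfolding lower_order_def abar_P_def epsbar_def prod.inject by metis
  \<comment> \<open>Distributivity is applied to vectors of the common dimension
    \<open>2 * nbus S\<close>.\<close>
  have "abar_P S E F i \<bullet> Yvec S E F k =
      a_P S E F i \<bullet> Yvec S E F k - a_ZIP S E F i \<bullet> Yvec S E F k"
    unfolding abar_P_def
    by (rule minus_scalar_prod_distrib[where n = "2 * nbus S"])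
      (simp_all add: a_P_def a_ZIP_def unit_pair_def Yvec_def)
  \<comment> \<open>This removes the term \<open>psp S i * rho k\<close> by which
    \<open>epsbar\<close> differs from \<open>eps\<close> minus \<open>b_ZIP\<close>.\<close>
  moreover have "rho k = 0" using k by (simp add: rho_def)
  ultimately show "DT (\<lambda>t. p_ZIP S e f i t) k = DT (\<lambda>t. - lam t * dp S i + p_flow S e f i t) k \<longleftrightarrow>
     0 = abar_P S E F i \<bullet> Yvec S E F k - dp S i * DT lam k + epsbar S E F k i"
    using DT_p_flow_eq[where e = e and f = f, OF e f lam k i]
      DT_p_ZIP_eq[where e = e and f = f, OF e[OF i] f[OF i] k i]
    unfolding E_def[symmetric] F_def[symmetric] epsbar_def by auto
qed

text \<open>Multiplying the admittances by the imaginary unit turns \<open>p_flow\<close> into \<open>q_flow\<close>.\<close>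

definition dual_network :: "zip_network \<Rightarrow> zip_network" where
  "dual_network S = S\<lparr>gmat := \<lambda>i j. - bmat S i j, bmat := gmat S, dp := dq S, psp := qsp S,
     zsp := \<lambda>i. \<i> * cnj (zsp S i), isp := \<lambda>i. \<i> * isp S i,
     alphaZ := betaZ S, alphaI := betaI S, alphaP := betaP S\<rparr>"

text \<open>Multiplication by \<open>\<i>\<close> sends the pair (g, b) to (-b, g). Moreover
  \<open>\<i> * cnj z\<close> has real part \<open>Im z\<close> and the modulus of \<open>z\<close>,
  while \<open>\<i> * isp S i\<close> has real part \<open>- Im (isp S i)\<close> and imaginary part
  \<open>Re (isp S i)\<close>; these replacements lead from \<open>p_ZIP\<close> to
  \<open>q_ZIP\<close>.\<close>

lemma dual_network_simps:
  "nbus (dual_network S) = nbus S"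
  "dp (dual_network S) = dq S"
  "p_flow (dual_network S) = q_flow S"
  "p_ZIP (dual_network S) = q_ZIP S"
  "abar_P (dual_network S) = abar_Q S"
  "epsbar (dual_network S) = mubar S"
  "Yvec (dual_network S) = Yvec S"
  "lower_order (dual_network S) = lower_order S"
proof -
  have "a_P (dual_network S) = a_Q S"
    by (intro ext) (simp add: a_P_def a_Q_def dual_network_def sum_negf sum_subtractf sum.distrib
      algebra_simps cong: if_cong)
  moreover have "a_ZIP (dual_network S) = c_ZIP S"
    by (intro ext) (simp add: a_ZIP_def c_ZIP_def unit_pair_def dual_network_def norm_mult)
  ultimately show "abar_P (dual_network S) = abar_Q S"
    by (intro ext) (simp add: abar_P_def abar_Q_def)
  show "epsbar (dual_network S) = mubar S"
    by (intro ext) (simp add: epsbar_def mubar_def eps_def mu_def b_ZIP_def d_ZIP_def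
      dual_network_def norm_mult sum_negf)
  show "p_flow (dual_network S) = q_flow S"
    by (intro ext) (simp add: p_flow_def q_flow_def dual_network_def sum_negf)
  show "p_ZIP (dual_network S) = q_ZIP S"
    by (intro ext) (simp add: p_ZIP_def q_ZIP_def dual_network_def norm_mult algebra_simps)
qed (auto simp: fun_eq_iff dual_network_def Yvec_def lower_order_def)

section \<open>Assembly of the five kinds of equations\<close>

theorem proposition4:
  fixes S :: zip_network
    and e f :: "nat \<Rightarrow> real \<Rightarrow> real"
    and lam :: "real \<Rightarrow> real"
    and k :: nat
  assumes "valid_network S"
    and "\<And>i. i \<in> {1..nbus S} \<Longrightarrow> smooth_near_0 (e i)"
    and "\<And>i. i \<in> {1..nbus S} \<Longrightarrow> smooth_near_0 (f i)"
    and "smooth_near_0 lam"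
    and "k \<ge> 1"
  shows
    "let E = (\<lambda>i. DT (e i)); F = (\<lambda>i. DT (f i)); L = DT lam; Y = Yvec S E F in
      (\<forall>i\<in>PV S.
        lower_order S k (\<lambda>E' F'. (a_P S E' F' i, eps S E' F' k i)) \<and>
        (DT (\<lambda>t. psp S i) k = DT (\<lambda>t. - lam t * dp S i + p_flow S e f i t) k \<longleftrightarrow>
         0 = a_P S E F i \<bullet> Y k - dp S i * L k + eps S E F k i)) \<and>
      (\<forall>i\<in>PQ S.
        lower_order S k (\<lambda>E' F'. (abar_P S E' F' i, epsbar S E' F' k i)) \<and>
        (DT (\<lambda>t. p_ZIP S e f i t) k = DT (\<lambda>t. - lam t * dp S i + p_flow S e f i t) k \<longleftrightarrow>
         0 = abar_P S E F i \<bullet> Y k - dp S i * L k + epsbar S E F k i)) \<and>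
      (\<forall>i\<in>PQ S.
        lower_order S k (\<lambda>E' F'. (abar_Q S E' F' i, mubar S E' F' k i)) \<and>
        (DT (\<lambda>t. q_ZIP S e f i t) k = DT (\<lambda>t. - lam t * dq S i + q_flow S e f i t) k \<longleftrightarrow>
         0 = abar_Q S E F i \<bullet> Y k - dq S i * L k + mubar S E F k i)) \<and>
      (\<forall>i\<in>PV S.
        lower_order S k (\<lambda>E' F'. (a_V S E' F' i, varsig S E' F' k i)) \<and>
        (DT (\<lambda>t. (vsp S i)\<^sup>2) k = DT (\<lambda>t. (e i t)\<^sup>2 + (f i t)\<^sup>2) k \<longleftrightarrow>
         0 = a_V S E F i \<bullet> Y k + 0 * L k + varsig S E F k i)) \<and>
      (\<forall>i\<in>REF S.
        (DT (\<lambda>t. esp S i) k = DT (\<lambda>t. e i t) k \<longleftrightarrow>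
         0 = a_E S i \<bullet> Y k + 0 * L k - esp S i * rho k) \<and>
        (DT (\<lambda>t. fsp S i) k = DT (\<lambda>t. f i t) k \<longleftrightarrow>
         0 = a_F S i \<bullet> Y k + 0 * L k - fsp S i * rho k))"
proof -
  define E F where "E = (\<lambda>i. DT (e i))" and "F = (\<lambda>i. DT (f i))"
  note k = assms(5)
  have bus: "i \<in> {1..nbus S}" if "i \<in> PQ S \<or> i \<in> PV S \<or> i \<in> REF S" for i
    using assms(1) that unfolding valid_network_def by blast
  \<comment> \<open>This evaluates the constant left sides of Z1, Z4 and Z5.\<close>
  have const: "DT (\<lambda>t. c) k = 0" for c
    using has_DT_unique[OF has_DT_const, of c k] k by (simp add: rho_def)
  have Z1: "lower_order S k (\<lambda>E' F'. (a_P S E' F' i, eps S E' F' k i)) \<and>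
      (DT (\<lambda>t. psp S i) k = DT (\<lambda>t. - lam t * dp S i + p_flow S e f i t) k \<longleftrightarrow>
       0 = a_P S E F i \<bullet> Yvec S E F k - dp S i * DT lam k + eps S E F k i)"
    if "i \<in> PV S" for i
  proof -
    have i: "i \<in> {1..nbus S}" using bus that by blast
    have "lower_order S k (\<lambda>E' F'. (a_P S E' F' i, eps S E' F' k i))"
      using lower_order_a_P[OF k i] lower_order_eps[OF i, of k]
      unfolding lower_order_def prod.inject by metis
    then show ?thesis
      by (simp only: const DT_p_flow_eq[where e = e and f = f, OF assms(2,3,4) k i] E_def F_def simp_thms)
  qed
  have Z2: "lower_order S k (\<lambda>E' F'. (abar_P S E' F' i, epsbar S E' F' k i)) \<and>
      (DT (\<lambda>t. p_ZIP S e f i t) k = DT (\<lambda>t. - lam t * dp S i + p_flow S e f i t) k \<longleftrightarrow>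
       0 = abar_P S E F i \<bullet> Yvec S E F k - dp S i * DT lam k + epsbar S E F k i)"
    if "i \<in> PQ S" for i
    unfolding E_def F_def using bus that by (intro ZIP_active_power assms(2-)) auto
  \<comment> \<open>\<open>dual_network S\<close> has the same number of buses, so the smoothness
    hypotheses carry over to it unchanged.\<close>
  have Z3: "lower_order S k (\<lambda>E' F'. (abar_Q S E' F' i, mubar S E' F' k i)) \<and>
      (DT (\<lambda>t. q_ZIP S e f i t) k = DT (\<lambda>t. - lam t * dq S i + q_flow S e f i t) k \<longleftrightarrow>
       0 = abar_Q S E F i \<bullet> Yvec S E F k - dq S i * DT lam k + mubar S E F k i)"
    if "i \<in> PQ S" for i
    unfolding E_def F_def
    using ZIP_active_power[of "dual_network S" e f lam k i, unfolded dual_network_simps,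
        OF assms(2-5) bus] that
    by blast
  have Z4: "lower_order S k (\<lambda>E' F'. (a_V S E' F' i, varsig S E' F' k i)) \<and>
      (DT (\<lambda>t. (vsp S i)\<^sup>2) k = DT (\<lambda>t. (e i t)\<^sup>2 + (f i t)\<^sup>2) k \<longleftrightarrow>
       0 = a_V S E F i \<bullet> Yvec S E F k + 0 * DT lam k + varsig S E F k i)"
    if "i \<in> PV S" for i
  proof -
    have i: "i \<in> {1..nbus S}" using bus that by blast
    then show ?thesis
      using lower_order_voltage_square[OF k i]
        DT_voltage_square[where e = e and f = f, OF assms(2,3)[OF i] k i]
      by (simp add: const E_def F_def)
  qed
  \<comment> \<open>\<open>a_E\<close> and \<open>a_F\<close> do not take \<open>E\<close> and
    \<open>F\<close> as arguments, so only the equivalences remain to be shown.\<close>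
  have Z5: "(DT (\<lambda>t. esp S i) k = DT (\<lambda>t. e i t) k \<longleftrightarrow>
       0 = a_E S i \<bullet> Yvec S E F k + 0 * DT lam k - esp S i * rho k) \<and>
      (DT (\<lambda>t. fsp S i) k = DT (\<lambda>t. f i t) k \<longleftrightarrow>
       0 = a_F S i \<bullet> Yvec S E F k + 0 * DT lam k - fsp S i * rho k)"
    if "i \<in> REF S" for i
    using bus[of i] that k
    by (simp add: const a_E_def a_F_def unit_pair_scalar_prod E_def F_def rho_def)
  show ?thesis
    unfolding Let_def E_def[symmetric] F_def[symmetric]
    using Z1 Z2 Z3 Z4 Z5 by blast
qed

end
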